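(* Let $X$ be a Tychonoff space. (i) If $X$ is separable and there exists an $\mathbb{R}$-universal $\omega^\omega$-based uniformity on $X$, then the function space $C_k(X)$ is Suslin. (ii) If $X$ is moreover an Ascoli space and $C_k(X)$ is Suslin, then $X$ is separable and there exists an $\mathbb{R}$-universal $\omega^\omega$-based uniformity on $X$. In particular, for an Ascoli Tychonoff space $X$, $C_k(X)$ is Suslin if and only if $X$ is separable and has an $\mathbb{R}$-universal $\omega^\omega$-based uniformity.
   Context: $C_k(X)$ is the set $C(X)$ of continuous real-valued functions on $X$ with the compact-open topology, i.e. the topology generated by the subbase of sets $\{f\in C(X):\min f(K)>r\}$ and $\{f\in C(X):\max f(K)<r\}$, where $K\subset X$ is nonempty compact and $r\in\mathbb{R}$. A topological space is Polish if it is homeomorphic to a separable complete metric space; it is Suslin if it is the image of a Polish space under a continuous map. A topological space $X$ is Ascoli if the canonical map $\delta:X\to C_k(C_k(X))$, $x\mapsto\delta_x$, where $\delta_x(f)=f(x)$ for $f\in C_k(X)$, is continuous. The set $\omega^\omega$ is partially ordered by $\alpha\le\beta$ iff $\alpha(n)\le\beta(n)$ for all $n\in\omega$. A uniformity $\mathcal U$ on a set $X$ is $\omega^\omega$-based if it has a base $(U_\alpha)_{\alpha\in\omega^\omega}$ such that $U_\beta\subset U_\alpha$ for all $\alpha\le\beta$ in $\omega^\omega$. A uniformity $\mathcal U$ on a topological space $X$ is $\mathbb{R}$-universal if it generates the topology of $X$ and every continuous function $f:X\to\mathbb{R}$ is uniformly continuous with respect to $\mathcal U$. *)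

theory Defs
  imports "HOL-Analysis.Analysis"
begin

text \<open>A continuous function on the carrier of \<open>X\<close> is represented by its extensional
  representative (value \<^term>\<open>undefined\<close> outside \<^term>\<open>topspace X\<close>), so that functions
  agreeing on \<^term>\<open>topspace X\<close> are equal.\<close>

definition real_cont_fun_set :: "'a topology \<Rightarrow> ('a \<Rightarrow> real) set" where
  "real_cont_fun_set X = {f \<in> extensional (topspace X). continuous_map X euclideanreal f}"

text \<open>For nonempty compact \<open>K\<close> the infimum and supremum of \<open>f ` K\<close> are attained, so they are
  \<open>min f(K)\<close> and \<open>max f(K)\<close>.  The whole set is adjoined as the empty intersection; this only
  matters when \<open>X\<close> is empty, where there are no subbasic sets.\<close>

definition compact_open_subbase :: "'a topology \<Rightarrow> ('a \<Rightarrow> real) set set" where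
  "compact_open_subbase X =
     {{f \<in> real_cont_fun_set X. Inf (f ` K) > r} | K r. compactin X K \<and> K \<noteq> {}} \<union>
     {{f \<in> real_cont_fun_set X. Sup (f ` K) < r} | K r. compactin X K \<and> K \<noteq> {}}"

definition Ck :: "'a topology \<Rightarrow> ('a \<Rightarrow> real) topology" where
  "Ck X = topology_generated_by (insert (real_cont_fun_set X) (compact_open_subbase X))"

lemma topspace_Ck: "topspace (Ck X) = real_cont_fun_set X"
  unfolding Ck_def topology_generated_by_topspace compact_open_subbase_def by auto


definition Tychonoff_space :: "'a topology \<Rightarrow> bool" where
  "Tychonoff_space X \<longleftrightarrow> completely_regular_space X \<and> Hausdorff_space X"

definition Polish_space :: "'a topology \<Rightarrow> bool" where
  "Polish_space X \<longleftrightarrow> completely_metrizable_space X \<and> separable_space X"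

lemma homeomorphic_Polish_space:
  "X homeomorphic_space Y \<Longrightarrow> Polish_space X \<longleftrightarrow> Polish_space Y"
  unfolding Polish_space_def
  using homeomorphic_completely_metrizable_space homeomorphic_separable_space by blast

text \<open>HOL cannot quantify over all types inside a formula, so the Polish space ranges over the
  topologies \<open>P\<close> whose carrier is a subset of the type \<^typ>\<open>nat \<Rightarrow> nat\<close>; the topology
  itself is arbitrary and unrelated to the product topology.  Since a Polish space has at most
  continuum many points, this is no restriction: see \<open>Suslin_spaceI\<close> below.\<close>

definition Suslin_space :: "'a topology \<Rightarrow> bool" where
  "Suslin_space X \<longleftrightarrow>
     (\<exists>(P :: (nat \<Rightarrow> nat) topology) f.
        Polish_space P \<and> continuous_map P X f \<and> f ` topspace P = topspace X)"

lemma Polish_space_copy: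
  fixes P :: "'b topology"
  assumes "Polish_space P"
  shows "\<exists>Q :: (nat \<Rightarrow> nat) topology. Q homeomorphic_space P"
proof -
  obtain M d where "Metric_space M d" and P: "P = Metric_space.mtopology M d"
    using assms by (auto simp: Polish_space_def completely_metrizable_space_def)
  interpret Metric_space M d by fact
  have tP: "topspace P = M"
    by (simp add: P)
  obtain D where D: "countable D" "D \<subseteq> M" and dense: "mtopology closure_of D = M"
    using assms unfolding Polish_space_def separable_space_def P by auto
  define h :: "'b \<Rightarrow> nat \<Rightarrow> nat" where
    "h x n = (case prod_decode n of (i, j) \<Rightarrow>
        if d (from_nat_into D i) x < inverse (real (Suc j)) then 1 else 0)" for x n
  have inj: "inj_on h (topspace P)"
  proof (rule inj_onI, rule ccontr)
    fix x y assume "x \<in> topspace P" "y \<in> topspace P" and eq: "h x = h y" and "x \<noteq> y"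
    then have x: "x \<in> M" and y: "y \<in> M"
      by (auto simp: tP)
    then have "d x y / 2 > 0"
      using \<open>x \<noteq> y\<close> mdist_pos_less by simp
    then obtain j where j: "inverse (real (Suc j)) < d x y / 2"
      using reals_Archimedean by blast
    have "\<forall>r>0. \<exists>c\<in>D. c \<in> mball x r"
      using dense x unfolding metric_closure_of by auto
    then obtain c where c: "c \<in> D" "c \<in> mball x (inverse (real (Suc j)))"
      by (meson inverse_positive_iff_positive of_nat_0_less_iff zero_less_Suc)
    then obtain i where i: "from_nat_into D i = c"
      using D(1) by (meson from_nat_into_surj)
    have cM: "c \<in> M" and cx: "d c x < inverse (real (Suc j))"
      using c D(2) by (auto simp: commute)
    then have "d c y < inverse (real (Suc j))"
      using fun_cong[OF eq, of "prod_encode (i, j)"] by (simp add: h_def i split: if_splits)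
    with cx j have "d c x + d c y < d x y"
      by linarith
    then show False
      using triangle[OF x cM y] by (simp add: commute)
  qed
  define g where "g = inv_into (topspace P) h"
  define Q where "Q = pullback_topology (h ` topspace P) g P"
  have gh: "\<And>x. x \<in> topspace P \<Longrightarrow> g (h x) = x"
    using inj by (simp add: g_def)
  have tQ: "topspace Q = h ` topspace P"
    unfolding Q_def topspace_pullback_topology using gh by auto
  have "continuous_map Q P g"
    unfolding Q_def using continuous_map_pullback[of P P id] by (simp add: comp_def)
  moreover have "continuous_map P Q h"
    unfolding Q_def
    by (rule continuous_map_pullback')
       (auto simp: gh intro: continuous_map_eq[of P P id])
  ultimately have "homeomorphic_maps Q P g h"
    unfolding homeomorphic_maps_def using gh tQ by auto
  then show ?thesis
    unfolding homeomorphic_space_def by blast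
qed

lemma Suslin_spaceI:
  fixes P :: "'b topology" and X :: "'a topology"
  assumes "Polish_space P" and f: "continuous_map P X f" "f ` topspace P = topspace X"
  shows "Suslin_space X"
proof -
  obtain Q :: "(nat \<Rightarrow> nat) topology" and g k where gk: "homeomorphic_maps Q P g k"
    using Polish_space_copy[OF assms(1)] unfolding homeomorphic_space_def by blast
  then have "Polish_space Q"
    using assms(1) homeomorphic_Polish_space unfolding homeomorphic_space_def by blast
  moreover have "continuous_map Q X (f \<circ> g)"
    using gk f(1) by (auto simp: homeomorphic_maps_def intro: continuous_map_compose)
  moreover have "(f \<circ> g) ` topspace Q = topspace X"
    using gk f(2) by (metis homeomorphic_imp_surjective_map homeomorphic_maps_map image_comp)
  ultimately show ?thesis
    unfolding Suslin_space_def by blast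
qed

definition Ascoli_space :: "'a topology \<Rightarrow> bool" where
  "Ascoli_space X \<longleftrightarrow>
     continuous_map X (Ck (Ck X)) (\<lambda>x. restrict (\<lambda>f. f x) (topspace (Ck X)))"


definition uniformity_on_set :: "'a set \<Rightarrow> 'a rel set \<Rightarrow> bool" where
  "uniformity_on_set S \<U> \<longleftrightarrow>
     \<U> \<noteq> {} \<and>
     (\<forall>U\<in>\<U>. Id_on S \<subseteq> U \<and> U \<subseteq> S \<times> S) \<and>
     (\<forall>U\<in>\<U>. \<forall>V. U \<subseteq> V \<and> V \<subseteq> S \<times> S \<longrightarrow> V \<in> \<U>) \<and>
     (\<forall>U\<in>\<U>. \<forall>V\<in>\<U>. U \<inter> V \<in> \<U>) \<and>
     (\<forall>U\<in>\<U>. U\<inverse> \<in> \<U>) \<and>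
     (\<forall>U\<in>\<U>. \<exists>V\<in>\<U>. V O V \<subseteq> U)"

definition omega_omega_based :: "'a rel set \<Rightarrow> bool" where
  "omega_omega_based \<U> \<longleftrightarrow>
     (\<exists>B :: (nat \<Rightarrow> nat) \<Rightarrow> 'a rel.
        (\<forall>\<alpha>. B \<alpha> \<in> \<U>) \<and> (\<forall>U\<in>\<U>. \<exists>\<alpha>. B \<alpha> \<subseteq> U) \<and>
        (\<forall>\<alpha> \<beta>. (\<forall>n. \<alpha> n \<le> \<beta> n) \<longrightarrow> B \<beta> \<subseteq> B \<alpha>))"

definition uniformity_generates :: "'a rel set \<Rightarrow> 'a topology \<Rightarrow> bool" where
  "uniformity_generates \<U> X \<longleftrightarrow>
     (\<forall>W. openin X W \<longleftrightarrow> W \<subseteq> topspace X \<and> (\<forall>x\<in>W. \<exists>U\<in>\<U>. U `` {x} \<subseteq> W))"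

definition uniformly_continuous_real :: "'a rel set \<Rightarrow> ('a \<Rightarrow> real) \<Rightarrow> bool" where
  "uniformly_continuous_real \<U> f \<longleftrightarrow>
     (\<forall>\<epsilon>>0. \<exists>U\<in>\<U>. \<forall>(x, y)\<in>U. \<bar>f x - f y\<bar> < \<epsilon>)"

definition R_universal :: "'a topology \<Rightarrow> 'a rel set \<Rightarrow> bool" where
  "R_universal X \<U> \<longleftrightarrow>
     uniformity_generates \<U> X \<and>
     (\<forall>f. continuous_map X euclideanreal f \<longrightarrow> uniformly_continuous_real \<U> f)"

definition has_R_universal_omega_omega_based_uniformity :: "'a topology \<Rightarrow> bool" where
  "has_R_universal_omega_omega_based_uniformity X \<longleftrightarrow>
     (\<exists>\<U>. uniformity_on_set (topspace X) \<U> \<and> R_universal X \<U> \<and> omega_omega_based \<U>)"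

end

theory Submission
  imports Defs
begin

text \<open>
  Both implications turn on monotone families of compact or equicontinuous sets indexed by
  \<open>\<omega>\<^sup>\<omega>\<close>.

  From the function space to the uniformity.  A Polish space is the union of compact sets
  \<open>K \<alpha>\<close> that increase with \<open>\<alpha>\<close> (\<open>Polish_space_compact_resolution\<close>), so a Suslin \<open>C\<^sub>k(X)\<close> is covered
  by an increasing family of compact sets of functions.  The entourages "all functions of the
  \<open>\<alpha>\<close>-th compact set differ by less than \<open>\<epsilon>\<close>" decrease with \<open>\<alpha>\<close>, and absorbing \<open>\<epsilon>\<close> into the first
  entry of \<open>\<alpha>\<close> gives an \<open>\<omega>\<^sup>\<omega>\<close>-base.  Every continuous function lies in one of the compact
  sets, hence is uniformly continuous, and complete regularity makes the uniform topology at
  least as fine as that of \<open>X\<close>.  It is no finer because in an Ascoli space compact subsets of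
  \<open>C\<^sub>k(X)\<close> are equicontinuous (\<open>Ascoli_space_compact_imp_equicontinuous\<close>).  Separability of \<open>X\<close>
  comes from a countable base of the Polish space: for each basic set, choose a point (if there is
  one) at which all the functions that it parametrizes are small
  (\<open>Suslin_Ck_imp_separable\<close>).

  From the uniformity to the function space.  A countable family of indices \<open>\<beta>\<^sub>n\<close>, coded as one
  \<open>\<beta>\<close>, prescribes a modulus of uniform continuity: \<open>|f x - f y| \<le> 1/(n+1)\<close> on the entourage of
  index \<open>\<beta>\<^sub>n\<close>.  The classes \<open>E \<beta>\<close> of functions with modulus \<open>\<beta>\<close> (\<open>modulus_class\<close>) increase with \<open>\<beta>\<close> and exhaust
  \<open>C(X)\<close>; inside one class, convergence on a dense sequence already forces
  uniform convergence on compact sets to a function of the same class (\<open>modulus_class_limit\<close>).  Let \<open>Z\<close>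
  (\<open>codes\<close>) be the set of pairs \<open>(\<alpha>, y)\<close> such that, for every \<open>n\<close>, the sequence \<open>y\<close> is a limit of restrictions
  to the dense sequence of functions from classes \<open>E \<beta>\<close> with \<open>\<beta>\<close> and \<open>\<alpha>\<close> equal below \<open>n\<close>.  This
  set is closed in \<open>\<omega>\<^sup>\<omega> \<times> \<real>\<^sup>\<omega>\<close>, so Polish.  Indices that agree with \<open>\<alpha>\<close> on longer and longer
  initial segments have a common upper bound (\<open>common_upper_bound_of_converging_sequences\<close>), which puts all the
  approximating functions into a single class.  Therefore every \<open>(\<alpha>, y) \<in> Z\<close> has \<open>y\<close> equal to the
  restriction of a continuous \<open>f\<close>, unique by density, and \<open>(\<alpha>, y) \<mapsto> f\<close> is continuous by the same
  argument.  Its image is all of \<open>C\<^sub>k(X)\<close>.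
\<close>

section \<open>Neighbourhoods in the compact-open topology\<close>

lemma restrict_in_real_cont_fun_set:
  assumes "continuous_map X euclideanreal f"
  shows "restrict f (topspace X) \<in> real_cont_fun_set X"
  unfolding real_cont_fun_set_def using assms
  by (auto intro: continuous_map_eq[OF assms])

lemma compact_image_real_cont_fun:
  assumes "f \<in> real_cont_fun_set X" "compactin X K"
  shows "compact (f ` K)"
  using assms image_compactin[of X K euclideanreal f] by (auto simp: real_cont_fun_set_def)

lemma bdd_image_real_cont_fun:
  assumes "f \<in> real_cont_fun_set X" "compactin X K"
  shows "bdd_below (f ` K)" "bdd_above (f ` K)"
  using compact_imp_bounded[OF compact_image_real_cont_fun[OF assms]]
  by (auto intro: bounded_imp_bdd_below bounded_imp_bdd_above)

lemma openin_Ck_Inf: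
  assumes "compactin X K" "K \<noteq> {}"
  shows "openin (Ck X) {f \<in> real_cont_fun_set X. Inf (f ` K) > r}"
  unfolding Ck_def
  by (rule topology_generated_by_Basis) (use assms in \<open>auto simp: compact_open_subbase_def\<close>)

lemma openin_Ck_Sup:
  assumes "compactin X K" "K \<noteq> {}"
  shows "openin (Ck X) {f \<in> real_cont_fun_set X. Sup (f ` K) < r}"
  unfolding Ck_def
  by (rule topology_generated_by_Basis) (use assms in \<open>auto simp: compact_open_subbase_def\<close>)

lemma continuous_map_Ck_eval:
  assumes "x \<in> topspace X"
  shows "continuous_map (Ck X) euclideanreal (\<lambda>f. f x)"
  unfolding continuous_map_upper_lower_semicontinuous_lt
proof (intro conjI allI)
  fix a :: real
  have K: "compactin X {x}"
    using assms by simp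
  show "openin (Ck X) {f \<in> topspace (Ck X). f x > a}"
    using openin_Ck_Inf[OF K, of a] by (simp add: topspace_Ck)
  show "openin (Ck X) {f \<in> topspace (Ck X). f x < a}"
    using openin_Ck_Sup[OF K, of a] by (simp add: topspace_Ck)
qed

text \<open>The subbase only controls extrema over compact sets.  Cutting \<open>K\<close> into finitely many compact
  pieces on which \<open>F\<close> is nearly constant turns bounds on extrema into closeness at each point.\<close>

lemma Ck_uniform_neighbourhood:
  assumes F: "F \<in> real_cont_fun_set Y" and K: "compactin Y K" and "\<epsilon> > 0"
  shows "\<exists>W. openin (Ck Y) W \<and> F \<in> W \<and> (\<forall>G\<in>W. \<forall>k\<in>K. \<bar>G k - F k\<bar> < \<epsilon>)"
proof -
  define \<delta> where "\<delta> = \<epsilon> / 3"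
  have "\<delta> > 0"
    using \<open>\<epsilon> > 0\<close> by (simp add: \<delta>_def)
  obtain T where T: "T \<subseteq> F ` K" "finite T" and cover: "F ` K \<subseteq> (\<Union>c\<in>T. ball c \<delta>)"
    using compactE_image[OF compact_image_real_cont_fun[OF F K], of "F ` K" "\<lambda>c. ball c \<delta>"] \<open>\<delta> > 0\<close>
    by (metis UN_I centre_in_ball open_ball subsetI)
  define L where "L c = {y \<in> topspace Y. F y \<in> cball c \<delta>} \<inter> K" for c
  have "closedin Y {y \<in> topspace Y. F y \<in> cball c \<delta>}" for c
    using F by (intro closedin_continuous_map_preimage[of _ euclideanreal])
      (auto simp: real_cont_fun_set_def)
  then have L: "compactin Y (L c)" for c
    unfolding L_def using K by (rule closed_Int_compactin)
  have KY: "K \<subseteq> topspace Y"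
    using K by (rule compactin_subset_topspace)
  have Lne: "L c \<noteq> {}" if c: "c \<in> T" for c
  proof -
    obtain k where "k \<in> K" "c = F k"
      using T(1) c by blast
    then show ?thesis
      using KY \<open>\<delta> > 0\<close> by (auto simp: L_def)
  qed
  define N where "N c = {G \<in> real_cont_fun_set Y. Inf (G ` L c) > c - 2 * \<delta>} \<inter>
                        {G \<in> real_cont_fun_set Y. Sup (G ` L c) < c + 2 * \<delta>}" for c
  define W where "W = topspace (Ck Y) \<inter> (\<Inter>c\<in>T. N c)"
  have "openin (Ck Y) (N c)" if "c \<in> T" for c
    unfolding N_def by (intro openin_Int openin_Ck_Inf openin_Ck_Sup L Lne that)
  then have "openin (Ck Y) W"
    unfolding W_def using T(2)
    by (cases "T = {}") (auto intro!: openin_Int openin_INT)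
  moreover have "F \<in> W"
  proof -
    have "F \<in> N c" if "c \<in> T" for c
    proof -
      have *: "c - \<delta> \<le> F k" "F k \<le> c + \<delta>" if "k \<in> L c" for k
        using that by (auto simp: L_def dist_real_def abs_le_iff)
      have "c - \<delta> \<le> Inf (F ` L c)"
        using Lne[OF that] *(1) by (rule cINF_greatest)
      moreover have "Sup (F ` L c) \<le> c + \<delta>"
        using Lne[OF that] *(2) by (rule cSUP_least)
      ultimately show ?thesis
        using \<open>\<delta> > 0\<close> F by (simp add: N_def)
    qed
    then show ?thesis
      using F by (simp add: W_def topspace_Ck)
  qed
  moreover have "\<bar>G k - F k\<bar> < \<epsilon>" if G: "G \<in> W" and k: "k \<in> K" for G k
  proof -
    obtain c where c: "c \<in> T" "\<bar>F k - c\<bar> < \<delta>"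
      using cover k by (auto simp: dist_real_def abs_minus_commute)
    then have kL: "k \<in> L c"
      using k KY by (auto simp: L_def dist_real_def)
    have GN: "G \<in> N c" and GC: "G \<in> real_cont_fun_set Y"
      using G c(1) by (auto simp: W_def topspace_Ck)
    have "Inf (G ` L c) \<le> G k" "G k \<le> Sup (G ` L c)"
      using bdd_image_real_cont_fun[OF GC L[of c]] kL by (auto intro: cINF_lower cSUP_upper)
    then show ?thesis
      using GN c(2) unfolding N_def \<delta>_def by auto argo+
  qed
  ultimately show ?thesis
    by blast
qed

text \<open>Uniform convergence on compact sets implies convergence in \<open>C\<^sub>k(X)\<close>; stated for
  subbasic sets, which is all that continuity of a map into \<open>C\<^sub>k(X)\<close> requires.\<close>

lemma eventually_in_compact_open_subbase:
  assumes V: "V \<in> compact_open_subbase X" "F \<in> V"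
    and G: "\<And>m::nat. G m \<in> real_cont_fun_set X"
    and lim: "\<And>K \<epsilon>. compactin X K \<Longrightarrow> \<epsilon> > 0 \<Longrightarrow>
                 eventually (\<lambda>m. \<forall>x\<in>K. \<bar>G m x - F x\<bar> < \<epsilon>) sequentially"
  shows "eventually (\<lambda>m. G m \<in> V) sequentially"
proof -
  obtain K r where K: "compactin X K" "K \<noteq> {}" and
    cases: "V = {f \<in> real_cont_fun_set X. Inf (f ` K) > r} \<or>
            V = {f \<in> real_cont_fun_set X. Sup (f ` K) < r}"
    using V(1) unfolding compact_open_subbase_def by blast
  have F: "F \<in> real_cont_fun_set X"
    using V(2) cases by auto
  note bdd = bdd_image_real_cont_fun[OF F K(1)]
  from cases show ?thesis
  proof
    assume V_eq: "V = {f \<in> real_cont_fun_set X. Inf (f ` K) > r}"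
    define \<epsilon> where "\<epsilon> = (Inf (F ` K) - r) / 2"
    have "\<epsilon> > 0"
      using V(2) by (simp add: V_eq \<epsilon>_def)
    show ?thesis
      using lim[OF K(1) \<open>\<epsilon> > 0\<close>]
    proof eventually_elim
      case (elim m)
      have "Inf (F ` K) - \<epsilon> \<le> G m x" if "x \<in> K" for x
        using elim that cINF_lower[OF bdd(1) that] by (force simp: abs_less_iff)
      then have "Inf (F ` K) - \<epsilon> \<le> Inf (G m ` K)"
        by (intro cINF_greatest K(2))
      moreover have "Inf (F ` K) - \<epsilon> > r"
        using \<open>\<epsilon> > 0\<close> by (simp add: \<epsilon>_def field_simps)
      ultimately show ?case
        using G by (simp add: V_eq)
    qed
  next
    assume V_eq: "V = {f \<in> real_cont_fun_set X. Sup (f ` K) < r}"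
    define \<epsilon> where "\<epsilon> = (r - Sup (F ` K)) / 2"
    have "\<epsilon> > 0"
      using V(2) by (simp add: V_eq \<epsilon>_def)
    show ?thesis
      using lim[OF K(1) \<open>\<epsilon> > 0\<close>]
    proof eventually_elim
      case (elim m)
      have "G m x \<le> Sup (F ` K) + \<epsilon>" if "x \<in> K" for x
        using elim that cSUP_upper[OF that bdd(2)] by (force simp: abs_less_iff)
      then have "Sup (G m ` K) \<le> Sup (F ` K) + \<epsilon>"
        by (intro cSUP_least K(2))
      moreover have "Sup (F ` K) + \<epsilon> < r"
        using \<open>\<epsilon> > 0\<close> by (simp add: \<epsilon>_def field_simps)
      ultimately show ?case
        using G by (simp add: V_eq)
    qed
  qed
qed

section \<open>From a Suslin function space to a universal uniformity\<close>

lemma (in Metric_space) dense_imp_close: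
  assumes "mtopology closure_of D = M" "x \<in> M" "r > 0"
  shows "\<exists>c\<in>D. c \<in> M \<and> d x c < r"
  using assms unfolding metric_closure_of by auto

text \<open>With a dense sequence \<open>p\<close>, let \<open>K \<alpha>\<close> be the set of points that for every \<open>n\<close> lie within
  \<open>1/(n+1)\<close> of one of \<open>p\<^sub>0, \<dots>, p\<^bsub>\<alpha> n\<^esub>\<close>.  It is closed and totally bounded, and density puts each
  point into some \<open>K \<alpha>\<close>.\<close>

lemma Polish_space_compact_resolution:
  assumes "Polish_space P"
  shows "\<exists>K :: (nat \<Rightarrow> nat) \<Rightarrow> 'a set.
           (\<forall>\<alpha>. compactin P (K \<alpha>)) \<and> (\<forall>\<alpha> \<beta>. (\<forall>n. \<alpha> n \<le> \<beta> n) \<longrightarrow> K \<alpha> \<subseteq> K \<beta>) \<and>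
           (\<forall>p\<in>topspace P. \<exists>\<alpha>. p \<in> K \<alpha>)"
proof (cases "topspace P = {}")
  case True
  then show ?thesis
    by (intro exI[of _ "\<lambda>_. {}"]) auto
next
  case False
  obtain M d where "Metric_space M d" and comp: "Metric_space.mcomplete M d"
    and P: "P = Metric_space.mtopology M d"
    using assms by (auto simp: Polish_space_def completely_metrizable_space_def)
  interpret Metric_space M d by fact
  obtain D where D: "countable D" "D \<subseteq> M" and dense: "mtopology closure_of D = M"
    using assms unfolding Polish_space_def separable_space_def P by auto
  have "D \<noteq> {}"
    using dense False P by auto
  define p where "p = from_nat_into D"
  have range_p: "range p = D"
    unfolding p_def using D(1) \<open>D \<noteq> {}\<close> by (simp add: range_from_nat_into)
  have pM: "p i \<in> M" for i
    using range_p D(2) by blast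
  define K where "K \<alpha> = (\<Inter>n. \<Union>i\<in>{..\<alpha> n}. mcball (p i) (inverse (real (Suc n))))"
    for \<alpha> :: "nat \<Rightarrow> nat"
  have KM: "K \<alpha> \<subseteq> M" for \<alpha>
    unfolding K_def by auto
  have "compactin mtopology (K \<alpha>)" for \<alpha>
  proof -
    have "closedin mtopology (K \<alpha>)"
      unfolding K_def by (intro closedin_INT closedin_Union) auto
    then have "mtopology closure_of K \<alpha> = K \<alpha>"
      by (simp add: closure_of_closedin)
    moreover have "mtotally_bounded (K \<alpha>)"
      unfolding mtotally_bounded_def
    proof (intro allI impI)
      fix \<epsilon> :: real assume "\<epsilon> > 0"
      then obtain n where n: "inverse (real (Suc n)) < \<epsilon> / 2"
        using reals_Archimedean[of "\<epsilon> / 2"] by auto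
      let ?r = "inverse (real (Suc n))"
      \<comment> \<open>Total boundedness asks for centres in the set itself, so each ball of radius \<open>1/(n+1)\<close>
        that meets it is replaced by a ball of radius \<open>\<epsilon> > 2/(n+1)\<close> around a common point.\<close>
      let ?I = "{i. i \<le> \<alpha> n \<and> K \<alpha> \<inter> mcball (p i) ?r \<noteq> {}}"
      define c where "c i = (SOME x. x \<in> K \<alpha> \<inter> mcball (p i) ?r)" for i
      have c: "c i \<in> K \<alpha> \<inter> mcball (p i) ?r" if "i \<in> ?I" for i
        unfolding c_def some_in_eq using that by blast
      show "\<exists>C. finite C \<and> C \<subseteq> K \<alpha> \<and> K \<alpha> \<subseteq> (\<Union>x\<in>C. mball x \<epsilon>)"
      proof (intro exI conjI)
        show "finite (c ` ?I)"
          by simp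
        show "c ` ?I \<subseteq> K \<alpha>"
          using c by blast
        show "K \<alpha> \<subseteq> (\<Union>x\<in>c ` ?I. mball x \<epsilon>)"
        proof
          fix x assume x: "x \<in> K \<alpha>"
          then obtain i where i: "i \<le> \<alpha> n" "x \<in> mcball (p i) ?r"
            unfolding K_def by blast
          then have iI: "i \<in> ?I"
            using x by blast
          have cM: "c i \<in> M" and xM: "x \<in> M"
            using c[OF iI] x KM by auto
          have "d (c i) (p i) \<le> ?r" "d (p i) x \<le> ?r"
            using c[OF iI] i by (auto simp: commute)
          then have "d (c i) x < \<epsilon>"
            using triangle[OF cM pM[of i] xM] n by linarith
          then show "x \<in> (\<Union>x\<in>c ` ?I. mball x \<epsilon>)"
            using iI cM xM by auto
        qed
      qed
    qed
    ultimately show ?thesis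
      using mtotally_bounded_eq_compact_closure_of[OF comp, of "K \<alpha>"] by simp
  qed
  moreover have "K \<alpha> \<subseteq> K \<beta>" if "\<forall>n. \<alpha> n \<le> \<beta> n" for \<alpha> \<beta>
    unfolding K_def using that
    by (intro INF_mono) (auto intro: order_trans)
  moreover have "\<exists>\<alpha>. x \<in> K \<alpha>" if "x \<in> topspace P" for x
  proof -
    have xM: "x \<in> M"
      using that P by simp
    have "\<exists>i. x \<in> mcball (p i) (inverse (real (Suc n)))" for n
    proof -
      obtain c where "c \<in> D" "c \<in> M" "d x c < inverse (real (Suc n))"
        using dense_imp_close[OF dense xM, of "inverse (real (Suc n))"] by auto
      moreover obtain i where "c = p i"
        using \<open>c \<in> D\<close> range_p by blast
      ultimately show ?thesis
        using xM by (auto simp: commute intro!: exI[of _ i])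
    qed
    then obtain \<alpha> where "\<And>n. x \<in> mcball (p (\<alpha> n)) (inverse (real (Suc n)))"
      by metis
    then show ?thesis
      unfolding K_def by blast
  qed
  ultimately show ?thesis
    using P by blast
qed

text \<open>Uniform closeness to \<open>\<delta>\<^sub>x\<close> on \<open>K\<close> is a neighbourhood of \<open>\<delta>\<^sub>x\<close> in \<open>C\<^sub>k(C\<^sub>k(X))\<close>; its preimage under
  the continuous map \<open>\<delta>\<close> is the required neighbourhood of \<open>x\<close>.\<close>

lemma Ascoli_space_compact_imp_equicontinuous:
  assumes "Ascoli_space X" and K: "compactin (Ck X) K" and x: "x \<in> topspace X" and "\<epsilon> > 0"
  shows "\<exists>W. openin X W \<and> x \<in> W \<and> (\<forall>y\<in>W. \<forall>f\<in>K. \<bar>f y - f x\<bar> < \<epsilon>)"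
proof -
  let ?\<delta> = "\<lambda>x. restrict (\<lambda>f. f x) (topspace (Ck X))"
  have cont: "continuous_map X (Ck (Ck X)) ?\<delta>"
    using assms(1) by (simp add: Ascoli_space_def)
  have "?\<delta> x \<in> real_cont_fun_set (Ck X)"
    using restrict_in_real_cont_fun_set[OF continuous_map_Ck_eval[OF x]] .
  then obtain W where W: "openin (Ck (Ck X)) W" "?\<delta> x \<in> W"
    and near: "\<forall>G\<in>W. \<forall>f\<in>K. \<bar>G f - ?\<delta> x f\<bar> < \<epsilon>"
    using Ck_uniform_neighbourhood[OF _ K \<open>\<epsilon> > 0\<close>] by blast
  have "openin X {y \<in> topspace X. ?\<delta> y \<in> W}"
    using cont W(1) by (rule openin_continuous_map_preimage)
  moreover have "\<bar>f y - f x\<bar> < \<epsilon>" if "?\<delta> y \<in> W" "f \<in> K" for y f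
    using near that compactin_subset_topspace[OF K] by fastforce
  ultimately show ?thesis
    using x W(2) by (intro exI[of _ "{y \<in> topspace X. ?\<delta> y \<in> W}"]) auto
qed

lemma completely_regular_separating_function:
  assumes "completely_regular_space X" "openin X W" "x \<in> W"
  shows "\<exists>f\<in>real_cont_fun_set X. f x = 0 \<and> (\<forall>y\<in>topspace X - W. f y = 1)"
proof -
  have "x \<in> topspace X"
    using assms(2,3) openin_subset by blast
  moreover have "closedin X (topspace X - W)"
    using assms(2) by blast
  ultimately obtain f :: "_ \<Rightarrow> real" where f: "continuous_map X (top_of_set {0..1}) f"
      "f x = 0" "f ` (topspace X - W) \<subseteq> {1}"
    using assms(1,3) unfolding completely_regular_space_def by blast
  then have "continuous_map X euclideanreal f"
    using continuous_map_into_fulltopology by blast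
  from restrict_in_real_cont_fun_set[OF this] show ?thesis
    using f \<open>x \<in> topspace X\<close> by (intro bexI[of _ "restrict f (topspace X)"]) auto
qed

lemma Polish_space_imp_second_countable:
  assumes "Polish_space P"
  shows "second_countable P"
proof -
  obtain M d where "Metric_space M d" and P: "P = Metric_space.mtopology M d"
    using assms by (auto simp: Polish_space_def completely_metrizable_space_def)
  interpret Metric_space M d by fact
  obtain D where D: "countable D" "D \<subseteq> M" and dense: "mtopology closure_of D = M"
    using assms unfolding Polish_space_def separable_space_def P by auto
  define \<B> where "\<B> = (\<lambda>(c, n). mball c (inverse (real (Suc n)))) ` (D \<times> (UNIV :: nat set))"
  have "\<exists>V\<in>\<B>. x \<in> V \<and> V \<subseteq> U" if U: "openin mtopology U" and "x \<in> U" for U x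
  proof -
    obtain r where r: "r > 0" "mball x r \<subseteq> U" and xM: "x \<in> M"
      using U \<open>x \<in> U\<close> unfolding openin_mtopology by blast
    obtain n where n: "inverse (real (Suc n)) < r / 2"
      using reals_Archimedean[of "r / 2"] r(1) by auto
    obtain c where c: "c \<in> D" "c \<in> M" "d x c < inverse (real (Suc n))"
      using dense_imp_close[OF dense xM, of "inverse (real (Suc n))"] by auto
    have "mball c (inverse (real (Suc n))) \<subseteq> mball x r"
    proof
      fix y assume y: "y \<in> mball c (inverse (real (Suc n)))"
      then have "d x y \<le> d x c + d c y"
        using triangle[OF xM c(2), of y] by simp
      then show "y \<in> mball x r"
        using y c n xM by auto
    qed
    moreover have "x \<in> mball c (inverse (real (Suc n)))"
      using c xM by (simp add: commute)
    ultimately show ?thesis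
      using r(2) c(1) by (intro bexI[of _ "mball c (inverse (real (Suc n)))"]) (auto simp: \<B>_def)
  qed
  moreover have "countable \<B>" "\<forall>V\<in>\<B>. openin mtopology V"
    using D(1) by (auto simp: \<B>_def)
  ultimately show ?thesis
    unfolding second_countable_def P by blast
qed

text \<open>Let \<open>g\<close> map a Polish space onto \<open>C\<^sub>k(X)\<close>.  A nonempty open set \<open>W\<close> contains the points where a
  suitable \<open>f = g p\<close> is below \<open>1/2\<close>.  Since evaluation at a zero \<open>x\<close> of \<open>f\<close> is continuous, a basic
  neighbourhood \<open>V\<close> of \<open>p\<close> consists of parameters of functions that are below \<open>1/2\<close> at \<open>x\<close>.  So the
  point chosen for \<open>V\<close> exists and lies in \<open>W\<close>.\<close>

lemma Suslin_Ck_imp_separable: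
  assumes "completely_regular_space X" and "Suslin_space (Ck X)"
  shows "separable_space X"
proof -
  obtain P :: "(nat \<Rightarrow> nat) topology" and g where "Polish_space P"
    and g: "continuous_map P (Ck X) g" "g ` topspace P = real_cont_fun_set X"
    using assms(2) unfolding Suslin_space_def topspace_Ck by blast
  obtain \<B> where \<B>: "countable \<B>"
    and base: "\<forall>U p. openin P U \<and> p \<in> U \<longrightarrow> (\<exists>V\<in>\<B>. p \<in> V \<and> V \<subseteq> U)"
    using Polish_space_imp_second_countable[OF \<open>Polish_space P\<close>]
    unfolding second_countable_def by blast
  define N where "N V = {z \<in> topspace X. \<forall>q\<in>V. \<bar>g q z\<bar> < 1/2}" for V
  define D where "D = (\<lambda>V. SOME z. z \<in> N V) ` {V \<in> \<B>. N V \<noteq> {}}"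
  have pick: "(SOME z. z \<in> N V) \<in> N V" if "N V \<noteq> {}" for V
    using that by (simp add: some_in_eq)
  then have DX: "D \<subseteq> topspace X"
    unfolding D_def N_def by blast
  have meets: "\<exists>y\<in>D. y \<in> W" if W: "openin X W" "x \<in> W" for W x
  proof -
    have x: "x \<in> topspace X"
      using W openin_subset by blast
    obtain f where f: "f \<in> real_cont_fun_set X" "f x = 0" "\<forall>y\<in>topspace X - W. f y = 1"
      using completely_regular_separating_function[OF assms(1) W] by blast
    obtain p where p: "p \<in> topspace P" "g p = f"
      using f(1) g(2) by (metis imageE)
    have "continuous_map P euclideanreal (\<lambda>q. g q x)"
      using continuous_map_compose[OF g(1) continuous_map_Ck_eval[OF x]] by (simp add: o_def)
    then have "openin P {q \<in> topspace P. g q x \<in> ball 0 (1/2)}"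
      by (rule openin_continuous_map_preimage) simp
    then obtain V where V: "V \<in> \<B>" "p \<in> V" "V \<subseteq> {q \<in> topspace P. g q x \<in> ball 0 (1/2)}"
      using base p f(2) by fastforce
    then have "x \<in> N V"
      using x by (auto simp: N_def)
    then have "N V \<noteq> {}"
      by blast
    define y where "y = (SOME z. z \<in> N V)"
    have "y \<in> N V" "y \<in> D"
      using pick[OF \<open>N V \<noteq> {}\<close>] V(1) \<open>N V \<noteq> {}\<close> by (auto simp: y_def D_def)
    then have "\<bar>f y\<bar> < 1/2" "y \<in> topspace X"
      using V(2) p by (auto simp: N_def)
    then have "y \<in> W"
      using f(3) by (cases "y \<in> W") auto
    with \<open>y \<in> D\<close> show ?thesis
      by blast
  qed
  then have "X closure_of D = topspace X"
    unfolding closure_of_def by auto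
  moreover have "countable D"
    unfolding D_def using \<B> by (intro countable_image) (auto intro: countable_subset)
  ultimately show ?thesis
    unfolding separable_space_def using DX by blast
qed

text \<open>The entry \<open>\<alpha> 0\<close> encodes the tolerance \<open>1/(\<alpha> 0 + 1)\<close> and the shifted sequence selects the
  compact set of functions that are tested.\<close>

lemma Ascoli_Suslin_Ck_imp_uniformity:
  fixes X :: "'a topology"
  assumes creg: "completely_regular_space X" and Asc: "Ascoli_space X" and "Suslin_space (Ck X)"
  shows "has_R_universal_omega_omega_based_uniformity X"
proof -
  obtain P :: "(nat \<Rightarrow> nat) topology" and g where "Polish_space P"
    and g: "continuous_map P (Ck X) g" "g ` topspace P = real_cont_fun_set X"
    using assms(3) unfolding Suslin_space_def topspace_Ck by blast
  obtain K :: "(nat \<Rightarrow> nat) \<Rightarrow> (nat \<Rightarrow> nat) set" where K: "\<forall>\<alpha>. compactin P (K \<alpha>)"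
    and mono: "\<forall>\<alpha> \<beta>. (\<forall>n. \<alpha> n \<le> \<beta> n) \<longrightarrow> K \<alpha> \<subseteq> K \<beta>"
    and cover: "\<forall>p\<in>topspace P. \<exists>\<alpha>. p \<in> K \<alpha>"
    using Polish_space_compact_resolution[OF \<open>Polish_space P\<close>] by blast
  let ?S = "topspace X"
  define B where "B \<alpha> = {(x, y). x \<in> ?S \<and> y \<in> ?S \<and>
      (\<forall>p\<in>K (\<lambda>n. \<alpha> (Suc n)). \<bar>g p x - g p y\<bar> < 1 / real (Suc (\<alpha> 0)))}" for \<alpha> :: "nat \<Rightarrow> nat"
  define \<U> where "\<U> = {U. U \<subseteq> ?S \<times> ?S \<and> (\<exists>\<alpha>. B \<alpha> \<subseteq> U)}"
  have BS: "B \<alpha> \<subseteq> ?S \<times> ?S" for \<alpha>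
    by (auto simp: B_def)
  have Bmono: "B \<beta> \<subseteq> B \<alpha>" if le: "\<forall>n. \<alpha> n \<le> \<beta> n" for \<alpha> \<beta>
  proof -
    have "K (\<lambda>n. \<alpha> (Suc n)) \<subseteq> K (\<lambda>n. \<beta> (Suc n))"
      using le by (intro mono[rule_format]) blast
    moreover have "1 / real (Suc (\<beta> 0)) \<le> 1 / real (Suc (\<alpha> 0))"
      using le by (simp add: frac_le)
    ultimately show ?thesis
      unfolding B_def by fastforce
  qed
  have Bin: "B \<alpha> \<in> \<U>" for \<alpha>
    using BS by (auto simp: \<U>_def)
  have half: "\<exists>\<beta>. B \<beta> O B \<beta> \<subseteq> B \<alpha>" for \<alpha>
  proof
    \<comment> \<open>Replacing \<open>\<alpha> 0\<close> by \<open>2 * \<alpha> 0 + 1\<close> halves the tolerance exactly.\<close>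
    let ?\<beta> = "\<alpha>(0 := 2 * \<alpha> 0 + 1)"
    show "B ?\<beta> O B ?\<beta> \<subseteq> B \<alpha>"
    proof clarify
      fix x y z assume xy: "(x, y) \<in> B ?\<beta>" and yz: "(y, z) \<in> B ?\<beta>"
      have eps: "2 * (1 / real (Suc (2 * \<alpha> 0 + 1))) = 1 / real (Suc (\<alpha> 0))"
        by (simp add: field_simps)
      have "\<bar>g p x - g p z\<bar> < 1 / real (Suc (\<alpha> 0))" if "p \<in> K (\<lambda>n. \<alpha> (Suc n))" for p
      proof -
        have "\<bar>g p x - g p y\<bar> < 1 / real (Suc (2 * \<alpha> 0 + 1))"
             "\<bar>g p y - g p z\<bar> < 1 / real (Suc (2 * \<alpha> 0 + 1))"
          using xy yz that by (auto simp: B_def)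
        then show ?thesis
          unfolding eps[symmetric] by linarith
      qed
      then show "(x, z) \<in> B \<alpha>"
        using xy yz by (auto simp: B_def)
    qed
  qed
  have "uniformity_on_set ?S \<U>"
    unfolding uniformity_on_set_def
  proof (intro conjI ballI allI impI)
    show "\<U> \<noteq> {}"
      using Bin by blast
  next
    fix U assume "U \<in> \<U>"
    then show "Id_on ?S \<subseteq> U" "U \<subseteq> ?S \<times> ?S"
      by (auto simp: \<U>_def B_def)
  next
    fix U V assume "U \<in> \<U>" "U \<subseteq> V \<and> V \<subseteq> ?S \<times> ?S"
    then show "V \<in> \<U>"
      by (auto simp: \<U>_def)
  next
    fix U V assume U: "U \<in> \<U>" and V: "V \<in> \<U>"
    obtain \<alpha> \<beta> where "B \<alpha> \<subseteq> U" "B \<beta> \<subseteq> V"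
      using U V by (auto simp: \<U>_def)
    moreover have "B (\<lambda>n. max (\<alpha> n) (\<beta> n)) \<subseteq> B \<alpha>" "B (\<lambda>n. max (\<alpha> n) (\<beta> n)) \<subseteq> B \<beta>"
      by (auto intro!: Bmono)
    ultimately have "B (\<lambda>n. max (\<alpha> n) (\<beta> n)) \<subseteq> U \<inter> V"
      by blast
    then show "U \<inter> V \<in> \<U>"
      using U by (auto simp: \<U>_def)
  next
    fix U assume U: "U \<in> \<U>"
    then obtain \<alpha> where \<alpha>: "B \<alpha> \<subseteq> U"
      by (auto simp: \<U>_def)
    have "B \<alpha> \<subseteq> (B \<alpha>)\<inverse>"
      by (auto simp: B_def abs_minus_commute)
    then have "B \<alpha> \<subseteq> U\<inverse>"
      using \<alpha> by blast
    then show "U\<inverse> \<in> \<U>"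
      using U by (auto simp: \<U>_def)
    obtain \<beta> where "B \<beta> O B \<beta> \<subseteq> B \<alpha>"
      using half by blast
    then show "\<exists>V\<in>\<U>. V O V \<subseteq> U"
      using Bin \<alpha> by blast
  qed
  moreover have "omega_omega_based \<U>"
    unfolding omega_omega_based_def
    using Bin Bmono by (intro exI[of _ B]) (auto simp: \<U>_def)
  moreover have "R_universal X \<U>"
    unfolding R_universal_def
  proof (intro conjI allI impI)
    have small: "\<exists>\<alpha>. \<forall>(x, y)\<in>B \<alpha>. \<bar>f x - f y\<bar> < \<epsilon>"
      if f: "f \<in> real_cont_fun_set X" and "\<epsilon> > 0" for f \<epsilon>
    proof -
      obtain p \<alpha> where p: "p \<in> K \<alpha>" "g p = f"
        using f g(2) cover by (metis imageE)
      obtain k where k: "1 / real (Suc k) < \<epsilon>"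
        using \<open>\<epsilon> > 0\<close> nat_approx_posE by blast
      have "\<forall>(x, y)\<in>B (case_nat k \<alpha>). \<bar>f x - f y\<bar> < \<epsilon>"
        using p k by (fastforce simp: B_def)
      then show ?thesis
        by blast
    qed
    show "uniformity_generates \<U> X"
      unfolding uniformity_generates_def
    proof (intro allI iffI conjI ballI)
      fix W x assume W: "openin X W" and x: "x \<in> W"
      have xS: "x \<in> ?S"
        using W x openin_subset by blast
      obtain f where f: "f \<in> real_cont_fun_set X" "f x = 0" "\<forall>y\<in>?S - W. f y = 1"
        using completely_regular_separating_function[OF creg W x] by blast
      obtain \<alpha> where \<alpha>: "\<forall>(x, y)\<in>B \<alpha>. \<bar>f x - f y\<bar> < 1"
        using small[OF f(1)] zero_less_one by blast
      have "B \<alpha> `` {x} \<subseteq> W"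
      proof
        fix y assume "y \<in> B \<alpha> `` {x}"
        then have xy: "(x, y) \<in> B \<alpha>"
          by simp
        then have "\<bar>f y\<bar> < 1"
          using \<alpha> f(2) by fastforce
        then show "y \<in> W"
          using f(3) xy BS[of \<alpha>] by (cases "y \<in> W") auto
      qed
      then show "\<exists>U\<in>\<U>. U `` {x} \<subseteq> W"
        using Bin by blast
    next
      fix W assume W: "W \<subseteq> ?S \<and> (\<forall>x\<in>W. \<exists>U\<in>\<U>. U `` {x} \<subseteq> W)"
      have "\<exists>T. openin X T \<and> x \<in> T \<and> T \<subseteq> W" if x: "x \<in> W" for x
      proof -
        obtain \<alpha> where \<alpha>: "B \<alpha> `` {x} \<subseteq> W"
          using W x by (fastforce simp: \<U>_def)
        have xS: "x \<in> ?S"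
          using W x by blast
        have "compactin (Ck X) (g ` K (\<lambda>n. \<alpha> (Suc n)))"
          using image_compactin[OF spec[OF K] g(1)] .
        from Ascoli_space_compact_imp_equicontinuous[OF Asc this xS, of "1 / real (Suc (\<alpha> 0))"]
        obtain T where T: "openin X T" "x \<in> T"
          and eq: "\<forall>y\<in>T. \<forall>f\<in>g ` K (\<lambda>n. \<alpha> (Suc n)). \<bar>f y - f x\<bar> < 1 / real (Suc (\<alpha> 0))"
          by auto
        have "T \<subseteq> B \<alpha> `` {x}"
          using T openin_subset[OF T(1)] eq xS by (auto simp: B_def abs_minus_commute)
        then show ?thesis
          using T \<alpha> by blast
      qed
      then show "openin X W"
        using openin_subopen by blast
    qed (use openin_subset in blast)
    fix f assume "continuous_map X euclideanreal f"
    from restrict_in_real_cont_fun_set[OF this]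
    have *: "\<exists>\<alpha>. \<forall>(x, y)\<in>B \<alpha>. \<bar>restrict f ?S x - restrict f ?S y\<bar> < \<epsilon>" if "\<epsilon> > 0" for \<epsilon>
      using small that by blast
    show "uniformly_continuous_real \<U> f"
      unfolding uniformly_continuous_real_def
    proof (intro allI impI)
      fix \<epsilon> :: real assume "\<epsilon> > 0"
      then obtain \<alpha> where "\<forall>(x, y)\<in>B \<alpha>. \<bar>restrict f ?S x - restrict f ?S y\<bar> < \<epsilon>"
        using * by blast
      then have "\<forall>(x, y)\<in>B \<alpha>. \<bar>f x - f y\<bar> < \<epsilon>"
        using BS by fastforce
      then show "\<exists>U\<in>\<U>. \<forall>(x, y)\<in>U. \<bar>f x - f y\<bar> < \<epsilon>"
        using Bin by blast
    qed
  qed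
  ultimately show ?thesis
    unfolding has_R_universal_omega_omega_based_uniformity_def by blast
qed

section \<open>From a universal uniformity to a Suslin function space\<close>

lemma tendsto_coordinate:
  fixes u :: "'b \<Rightarrow> 'i \<Rightarrow> 'c::topological_space"
  assumes "(u \<longlongrightarrow> l) F"
  shows "((\<lambda>m. u m i) \<longlongrightarrow> l i) F"
proof -
  have "continuous_on UNIV (\<lambda>x::'i \<Rightarrow> 'c. x i)"
    by simp
  then have "open ((\<lambda>x::'i \<Rightarrow> 'c. x i) -` S)" if "open S" for S
    using that unfolding continuous_on_open_vimage[OF open_UNIV] by simp
  then show ?thesis
    using topological_tendstoD[OF assms] by (intro topological_tendstoI) fastforce
qed

lemma eventually_agree_below:
  fixes u :: "'b \<Rightarrow> nat \<Rightarrow> nat"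
  assumes "(u \<longlongrightarrow> \<alpha>) F"
  shows "eventually (\<lambda>m. \<forall>i<n. u m i = \<alpha> i) F"
proof -
  have "eventually (\<lambda>m. u m i = \<alpha> i) F" for i
    using topological_tendstoD[OF tendsto_coordinate[OF assms, of i] open_discrete, of "{\<alpha> i}"] by simp
  then have "eventually (\<lambda>m. \<forall>i\<in>{..<n}. u m i = \<alpha> i) F"
    by (intro eventually_ball_finite) auto
  then show ?thesis
    by (auto elim: eventually_mono)
qed

text \<open>In each coordinate only finitely many \<open>\<beta> m\<close> can differ from \<open>\<alpha>\<close>, so a pointwise maximum
  exists; below \<open>k\<close> all of them equal \<open>\<alpha>\<close>, so the bound can be taken to do so as well.\<close>

lemma common_upper_bound_of_converging_sequences:
  fixes \<alpha> :: "nat \<Rightarrow> nat"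
  assumes agree: "\<And>m i. i < m + k \<Longrightarrow> \<beta> m i = \<alpha> i"
  shows "\<exists>\<gamma>. (\<forall>i<k. \<gamma> i = \<alpha> i) \<and> (\<forall>m i. \<beta> m i \<le> \<gamma> i)"
proof -
  \<comment> \<open>The index \<open>Suc i\<close> is included because \<open>\<beta> (Suc i) i = \<alpha> i\<close> is the value of all later terms.\<close>
  define \<gamma> where "\<gamma> i = (if i < k then \<alpha> i else Max ((\<lambda>m. \<beta> m i) ` {..Suc i}))" for i
  have "\<beta> m i \<le> \<gamma> i" for m i
  proof (cases "i < k")
    case True
    then show ?thesis
      using agree[of i m] by (simp add: \<gamma>_def)
  next
    case False
    show ?thesis
    proof (cases "m \<le> Suc i")
      case True
      with False show ?thesis
        unfolding \<gamma>_def by (auto intro!: Max_ge)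
    next
      case False': False
      then have "\<beta> m i = \<beta> (Suc i) i"
        using agree[of i m] agree[of i "Suc i"] by simp
      then show ?thesis
        using False unfolding \<gamma>_def by (auto intro!: Max_ge)
    qed
  qed
  then show ?thesis
    by (intro exI[of _ \<gamma>]) (simp add: \<gamma>_def)
qed

lemma Polish_space_closed_subset:
  fixes C :: "((nat \<Rightarrow> nat) \<times> (nat \<Rightarrow> real)) set"
  assumes "closed C"
  shows "Polish_space (top_of_set C)"
proof -
  have nat: "(euclidean :: nat topology) = discrete_topology UNIV"
    by (simp add: topology_eq open_discrete)
  have "completely_metrizable_space (euclidean :: (nat \<Rightarrow> nat) topology)"
    unfolding euclidean_product_topology[symmetric] nat
    by (simp add: completely_metrizable_space_product_topology completely_metrizable_space_discrete_topology)
  moreover have "completely_metrizable_space (euclidean :: (nat \<Rightarrow> real) topology)"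
    by (rule completely_metrizable_space_euclidean)
  ultimately have "completely_metrizable_space
      (prod_topology (euclidean :: (nat \<Rightarrow> nat) topology) (euclidean :: (nat \<Rightarrow> real) topology))"
    unfolding completely_metrizable_space_prod_topology by blast
  then have "completely_metrizable_space (top_of_set C)"
    using assms by (intro completely_metrizable_space_closedin) simp_all
  moreover have "second_countable (euclidean :: ((nat \<Rightarrow> nat) \<times> (nat \<Rightarrow> real)) topology)"
  proof -
    obtain \<B> :: "((nat \<Rightarrow> nat) \<times> (nat \<Rightarrow> real)) set set" where \<B>: "countable \<B>"
        "\<And>V. V \<in> \<B> \<Longrightarrow> open V" "\<And>S. open S \<Longrightarrow> \<exists>\<V>. \<V> \<subseteq> \<B> \<and> S = \<Union>\<V>"
      by (rule univ_second_countable) blast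
    then have "\<exists>V\<in>\<B>. x \<in> V \<and> V \<subseteq> U" if "open U" "x \<in> U" for U x
      using that by (metis UnionE Union_upper subsetD)
    then show ?thesis
      unfolding second_countable_def using \<B>(1,2) by (intro exI[of _ \<B>]) auto
  qed
  ultimately show ?thesis
    by (simp add: Polish_space_def second_countable_imp_separable_space second_countable_subtopology)
qed

text \<open>A single sequence codes countably many of them, one for each tolerance \<open>1/(n+1)\<close>; coding by
  coordinates keeps the pointwise order.\<close>

definition slice :: "(nat \<Rightarrow> nat) \<Rightarrow> nat \<Rightarrow> nat \<Rightarrow> nat" where
  "slice \<beta> n k = \<beta> (prod_encode (n, k))"

locale separable_omega_omega_based_uniformity =
  fixes X :: "'a topology" and \<U> :: "'a rel set"
    and B :: "(nat \<Rightarrow> nat) \<Rightarrow> 'a rel" and d :: "nat \<Rightarrow> 'a"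
  assumes uniformity: "uniformity_on_set (topspace X) \<U>"
    and generates: "uniformity_generates \<U> X"
    and universal: "\<And>f. continuous_map X euclideanreal f \<Longrightarrow> uniformly_continuous_real \<U> f"
    and B_entourage: "\<And>\<alpha>. B \<alpha> \<in> \<U>"
    and B_base: "\<And>U. U \<in> \<U> \<Longrightarrow> \<exists>\<alpha>. B \<alpha> \<subseteq> U"
    and B_antimono: "\<And>\<alpha> \<beta>. (\<And>n. \<alpha> n \<le> \<beta> n) \<Longrightarrow> B \<beta> \<subseteq> B \<alpha>"
    and range_d: "range d \<subseteq> topspace X"
    and dense: "X closure_of range d = topspace X"
begin

definition modulus_class :: "(nat \<Rightarrow> nat) \<Rightarrow> ('a \<Rightarrow> real) set" where
  "modulus_class \<beta> = {f \<in> real_cont_fun_set X.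
     \<forall>n. \<forall>(x, y)\<in>B (slice \<beta> n). \<bar>f x - f y\<bar> \<le> 1 / real (Suc n)}"

text \<open>This class depends on \<open>\<alpha>\<close> only through finitely many entries, hence locally constantly; that
  is what makes the set of codes below closed.\<close>

definition prefix_class :: "(nat \<Rightarrow> nat) \<Rightarrow> nat \<Rightarrow> ('a \<Rightarrow> real) set" where
  "prefix_class \<alpha> n = (\<Union>\<beta>\<in>{\<beta>. \<forall>i<n. \<beta> i = \<alpha> i}. modulus_class \<beta>)"

definition sample :: "('a \<Rightarrow> real) \<Rightarrow> nat \<Rightarrow> real" where
  "sample f = (\<lambda>k. f (d k))"

text \<open>The pairs \<open>(\<alpha>, sample f)\<close> with \<open>f \<in> modulus_class \<alpha>\<close> need not form a closed set, since \<open>B\<close> is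
  only monotone: a limit of such functions with indices converging to \<open>\<alpha>\<close> is known to have, for each \<open>n\<close>,
  a modulus that agrees with \<open>\<alpha>\<close> below \<open>n\<close>, but not \<open>\<alpha>\<close> itself.  Asking for approximation at
  every level \<open>n\<close> keeps these limits.\<close>

definition codes :: "((nat \<Rightarrow> nat) \<times> (nat \<Rightarrow> real)) set" where
  "codes = {(\<alpha>, y). \<forall>n. y \<in> closure (sample ` prefix_class \<alpha> n)}"

definition decode :: "(nat \<Rightarrow> nat) \<times> (nat \<Rightarrow> real) \<Rightarrow> 'a \<Rightarrow> real" where
  "decode z = inv_into (real_cont_fun_set X) sample (snd z)"

lemma entourage_bounds:
  assumes "U \<in> \<U>"
  shows "Id_on (topspace X) \<subseteq> U" "U \<subseteq> topspace X \<times> topspace X"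
proof -
  have "\<forall>U\<in>\<U>. Id_on (topspace X) \<subseteq> U \<and> U \<subseteq> topspace X \<times> topspace X"
    using uniformity unfolding uniformity_on_set_def by (elim conjE)
  with assms show "Id_on (topspace X) \<subseteq> U" "U \<subseteq> topspace X \<times> topspace X"
    by blast+
qed

lemmas entourage_subset = entourage_bounds(2)

lemma entourage_refl: "U \<in> \<U> \<Longrightarrow> x \<in> topspace X \<Longrightarrow> (x, x) \<in> U"
  using entourage_bounds(1) by blast

lemma entourage_half:
  assumes "U \<in> \<U>"
  shows "\<exists>V\<in>\<U>. V O V \<subseteq> U"
proof -
  have "\<forall>U\<in>\<U>. \<exists>V\<in>\<U>. V O V \<subseteq> U"
    using uniformity unfolding uniformity_on_set_def by (elim conjE)
  with assms show ?thesis
    by blast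
qed

text \<open>The set of points \<open>y\<close> with \<open>V `` {y} \<subseteq> U `` {x}\<close> for some entourage \<open>V\<close> is the interior of
  \<open>U `` {x}\<close>; it is open because entourages can be halved.\<close>

lemma entourage_neighbourhood:
  assumes U: "U \<in> \<U>" and x: "x \<in> topspace X"
  shows "\<exists>W. openin X W \<and> x \<in> W \<and> W \<subseteq> U `` {x}"
proof -
  define W where "W = {y \<in> topspace X. \<exists>V\<in>\<U>. V `` {y} \<subseteq> U `` {x}}"
  have "\<exists>V\<in>\<U>. V `` {y} \<subseteq> W" if "y \<in> W" for y
  proof -
    obtain V where V: "V \<in> \<U>" "V `` {y} \<subseteq> U `` {x}"
      using \<open>y \<in> W\<close> by (auto simp: W_def)
    obtain V' where V': "V' \<in> \<U>" "V' O V' \<subseteq> V"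
      using entourage_half[OF V(1)] by blast
    have "V' `` {y} \<subseteq> W"
    proof
      fix z assume z: "z \<in> V' `` {y}"
      then have "V' `` {z} \<subseteq> V `` {y}"
        using V'(2) by blast
      then show "z \<in> W"
        using z V V' entourage_subset[OF V'(1)] by (auto simp: W_def)
    qed
    then show ?thesis
      using V'(1) by blast
  qed
  then have "openin X W"
    using generates by (auto simp: uniformity_generates_def W_def)
  moreover have "W \<subseteq> U `` {x}"
    using entourage_refl by (auto simp: W_def)
  moreover have "x \<in> W"
    using x U by (auto simp: W_def)
  ultimately show ?thesis
    by blast
qed

lemma entourage_meets_dense_sequence:
  assumes U: "U \<in> \<U>" and x: "x \<in> topspace X"
  shows "\<exists>k. (x, d k) \<in> U"
proof -
  obtain W where W: "openin X W" "x \<in> W" "W \<subseteq> U `` {x}"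
    using entourage_neighbourhood[OF assms] by blast
  have "x \<in> X closure_of range d"
    using x dense by simp
  then have "\<exists>y. y \<in> range d \<and> y \<in> W"
    using W(1,2) by (simp add: in_closure_of)
  then obtain k where "d k \<in> W"
    by auto
  then have "(x, d k) \<in> U"
    using W(3) by auto
  then show ?thesis ..
qed

lemma continuous_map_if_uniformly_small:
  assumes "\<And>n. \<exists>U\<in>\<U>. \<forall>(x, y)\<in>U. \<bar>f x - f y\<bar> \<le> 1 / real (Suc n)"
  shows "continuous_map X euclideanreal f"
  unfolding continuous_map_def
proof (intro conjI allI impI)
  fix T :: "real set" assume "openin euclideanreal T"
  then have "open T"
    by simp
  let ?V = "{x \<in> topspace X. f x \<in> T}"
  have "\<exists>U\<in>\<U>. U `` {x} \<subseteq> ?V" if x: "x \<in> ?V" for x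
  proof -
    obtain e where e: "e > 0" "ball (f x) e \<subseteq> T"
      using \<open>open T\<close> x open_contains_ball by blast
    obtain n where n: "1 / real (Suc n) < e"
      using e(1) nat_approx_posE by blast
    obtain U where U: "U \<in> \<U>" "\<forall>(x, y)\<in>U. \<bar>f x - f y\<bar> \<le> 1 / real (Suc n)"
      using assms by blast
    have "U `` {x} \<subseteq> ?V"
    proof
      fix y assume "y \<in> U `` {x}"
      then have xy: "(x, y) \<in> U"
        by simp
      then have "f y \<in> ball (f x) e"
        using U(2) n by (fastforce simp: dist_real_def)
      then show "y \<in> ?V"
        using xy e(2) entourage_subset[OF U(1)] by blast
    qed
    then show ?thesis
      using U(1) by blast
  qed
  then show "openin X ?V"
    using generates unfolding uniformity_generates_def by blast
qed simp

lemma modulus_class_subset: "modulus_class \<beta> \<subseteq> real_cont_fun_set X"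
  by (auto simp: modulus_class_def)

lemma prefix_class_subset: "prefix_class \<alpha> n \<subseteq> real_cont_fun_set X"
  using modulus_class_subset by (auto simp: prefix_class_def)

lemma modulus_classD:
  "f \<in> modulus_class \<beta> \<Longrightarrow> (x, y) \<in> B (slice \<beta> n) \<Longrightarrow> \<bar>f x - f y\<bar> \<le> 1 / real (Suc n)"
  unfolding modulus_class_def by blast

lemma modulus_class_mono:
  assumes "\<And>i. \<beta> i \<le> \<gamma> i"
  shows "modulus_class \<beta> \<subseteq> modulus_class \<gamma>"
proof -
  have "B (slice \<gamma> n) \<subseteq> B (slice \<beta> n)" for n
    using assms by (intro B_antimono) (simp add: slice_def)
  then show ?thesis
    unfolding modulus_class_def by blast
qed

lemma modulus_class_cover:
  assumes f: "f \<in> real_cont_fun_set X"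
  shows "\<exists>\<beta>. f \<in> modulus_class \<beta>"
proof -
  have uc: "uniformly_continuous_real \<U> f"
    using f by (intro universal) (simp add: real_cont_fun_set_def)
  have "\<exists>\<alpha>. \<forall>(x, y)\<in>B \<alpha>. \<bar>f x - f y\<bar> \<le> 1 / real (Suc n)" for n
  proof -
    obtain U where "U \<in> \<U>" "\<forall>(x, y)\<in>U. \<bar>f x - f y\<bar> < 1 / real (Suc n)"
      using uc unfolding uniformly_continuous_real_def by (meson of_nat_0_less_iff zero_less_Suc zero_less_divide_1_iff)
    moreover from this obtain \<alpha> where "B \<alpha> \<subseteq> U"
      using B_base by blast
    ultimately show ?thesis
      by fastforce
  qed
  then obtain a where a: "\<And>n. \<forall>(x, y)\<in>B (a n). \<bar>f x - f y\<bar> \<le> 1 / real (Suc n)"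
    by metis
  define \<beta> where "\<beta> i = (case prod_decode i of (n, k) \<Rightarrow> a n k)" for i
  have "slice \<beta> n = a n" for n
    by (rule ext) (simp add: slice_def \<beta>_def)
  then have "f \<in> modulus_class \<beta>"
    using f a by (simp add: modulus_class_def)
  then show ?thesis
    by blast
qed

lemma inj_on_sample: "inj_on sample (real_cont_fun_set X)"
proof (rule inj_onI)
  fix f g assume f: "f \<in> real_cont_fun_set X" and g: "g \<in> real_cont_fun_set X"
    and eq: "sample f = sample g"
  show "f = g"
  proof (rule extensionalityI[of _ "topspace X"])
    fix x assume "x \<in> topspace X"
    then have "x \<in> X closure_of range d"
      using dense by simp
    then show "f x = g x"
    proof (rule forall_in_closure_of_eq[where Y = euclideanreal])
      show "f z = g z" if "z \<in> range d" for z
        using that fun_cong[OF eq] by (auto simp: sample_def)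
    qed (use f g in \<open>auto simp: real_cont_fun_set_def\<close>)
  qed (use f g in \<open>auto simp: real_cont_fun_set_def\<close>)
qed

lemma decode_eq: "f \<in> real_cont_fun_set X \<Longrightarrow> snd z = sample f \<Longrightarrow> decode z = f"
  using inj_on_sample by (simp add: decode_def)

text \<open>The Arzela--Ascoli argument: a common modulus carries convergence from the dense sequence
  to every point and then, by a finite cover, uniformly to compact sets.\<close>

lemma modulus_class_limit:
  assumes f: "\<And>m::nat. f m \<in> modulus_class \<gamma>" and lim: "(\<lambda>m. sample (f m)) \<longlonglongrightarrow> y"
  shows "\<exists>F\<in>modulus_class \<gamma>. sample F = y \<and>
           (\<forall>K \<epsilon>. compactin X K \<longrightarrow> \<epsilon> > 0 \<longrightarrow>
              eventually (\<lambda>m. \<forall>x\<in>K. \<bar>f m x - F x\<bar> < \<epsilon>) sequentially)"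
proof -
  have lim_d: "(\<lambda>m. f m (d k)) \<longlonglongrightarrow> y k" for k
    using tendsto_coordinate[OF lim, of k] by (simp add: sample_def)
  have conv: "convergent (\<lambda>m. f m x)" if x: "x \<in> topspace X" for x
  proof (rule Cauchy_convergent, rule metric_CauchyI)
    fix e :: real assume "e > 0"
    then obtain n where n: "1 / real (Suc n) < e / 3"
      using nat_approx_posE[of "e / 3"] by auto
    obtain k where k: "(x, d k) \<in> B (slice \<gamma> n)"
      using entourage_meets_dense_sequence[OF B_entourage x] by blast
    have "Cauchy (\<lambda>m. f m (d k))"
      using LIMSEQ_imp_Cauchy[OF lim_d] .
    then obtain N where N: "\<And>p q. p \<ge> N \<Longrightarrow> q \<ge> N \<Longrightarrow> dist (f p (d k)) (f q (d k)) < e / 3"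
      using \<open>e > 0\<close> by (metis metric_CauchyD zero_less_divide_iff zero_less_numeral)
    have "dist (f p x) (f q x) < e" if "p \<ge> N" "q \<ge> N" for p q
      using N[OF that] modulus_classD[OF f k, of p] modulus_classD[OF f k, of q] n
      unfolding dist_real_def by linarith
    then show "\<exists>M. \<forall>p\<ge>M. \<forall>q\<ge>M. dist (f p x) (f q x) < e"
      by blast
  qed
  define F where "F = restrict (\<lambda>x. lim (\<lambda>m. f m x)) (topspace X)"
  have F: "(\<lambda>m. f m x) \<longlonglongrightarrow> F x" if "x \<in> topspace X" for x
    using conv[OF that] that by (simp add: F_def convergent_LIMSEQ_iff)
  have small: "\<bar>F x - F z\<bar> \<le> 1 / real (Suc n)" if xz: "(x, z) \<in> B (slice \<gamma> n)" for x z n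
  proof -
    have "x \<in> topspace X" "z \<in> topspace X"
      using xz entourage_subset[OF B_entourage] by blast+
    then have "(\<lambda>m. \<bar>f m x - f m z\<bar>) \<longlonglongrightarrow> \<bar>F x - F z\<bar>"
      by (intro tendsto_intros F)
    then show ?thesis
      by (rule LIMSEQ_le_const2) (use modulus_classD[OF f xz] in blast)
  qed
  then have "continuous_map X euclideanreal F"
    using B_entourage by (intro continuous_map_if_uniformly_small) blast
  then have "F \<in> real_cont_fun_set X"
    by (simp add: real_cont_fun_set_def F_def)
  then have "F \<in> modulus_class \<gamma>"
    unfolding modulus_class_def using small by auto
  moreover have "sample F = y"
    using LIMSEQ_unique[OF F lim_d] range_d by (simp add: sample_def fun_eq_iff image_subset_iff)
  moreover have "eventually (\<lambda>m. \<forall>x\<in>K. \<bar>f m x - F x\<bar> < \<epsilon>) sequentially"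
    if K: "compactin X K" and "\<epsilon> > 0" for K \<epsilon>
  proof -
    obtain n where n: "1 / real (Suc n) < \<epsilon> / 3"
      using \<open>\<epsilon> > 0\<close> nat_approx_posE[of "\<epsilon> / 3"] by auto
    have KX: "K \<subseteq> topspace X"
      using K by (rule compactin_subset_topspace)
    have "\<forall>x\<in>K. \<exists>W. openin X W \<and> x \<in> W \<and> W \<subseteq> B (slice \<gamma> n) `` {x}"
      using entourage_neighbourhood[OF B_entourage] KX by blast
    then obtain W where W: "\<forall>x\<in>K. openin X (W x) \<and> x \<in> W x \<and> W x \<subseteq> B (slice \<gamma> n) `` {x}"
      by metis
    then obtain \<F> where "finite \<F>" "\<F> \<subseteq> W ` K" "K \<subseteq> \<Union>\<F>"
      using compactinD[OF K, of "W ` K"] by blast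
    then obtain T where T: "finite T" "T \<subseteq> K" and cover: "K \<subseteq> \<Union>(W ` T)"
      by (metis finite_subset_image)
    have "eventually (\<lambda>m. \<forall>t\<in>T. \<bar>f m t - F t\<bar> < \<epsilon> / 3) sequentially"
    proof (intro eventually_ball_finite[OF T(1)] ballI)
      fix t assume "t \<in> T"
      then have "(\<lambda>m. f m t) \<longlonglongrightarrow> F t"
        using T(2) KX by (intro F) blast
      then show "eventually (\<lambda>m. \<bar>f m t - F t\<bar> < \<epsilon> / 3) sequentially"
        using \<open>\<epsilon> > 0\<close> tendstoD[of "\<lambda>m. f m t" "F t" sequentially "\<epsilon> / 3"]
        by (simp add: dist_real_def)
    qed
    then show ?thesis
    proof eventually_elim
      case (elim m)
      show ?case
      proof
        fix x assume "x \<in> K"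
        then obtain t where t: "t \<in> T" "x \<in> W t"
          using cover by blast
        then have tx: "(t, x) \<in> B (slice \<gamma> n)"
          using W T(2) by blast
        show "\<bar>f m x - F x\<bar> < \<epsilon>"
          using modulus_classD[OF f tx, of m] small[OF tx] bspec[OF elim t(1)] n by linarith
      qed
    qed
  qed
  ultimately show ?thesis
    by blast
qed

text \<open>For fixed \<open>k\<close>, the \<open>m\<close>-th approximation of \<open>y\<close> is taken at level \<open>m + k\<close>.  Then the moduli have
  a common bound \<open>\<gamma>\<close> that agrees with \<open>\<alpha>\<close> below \<open>k\<close>, and the limit has modulus \<open>\<gamma>\<close>.  By density of
  the sample points the limit function is the same for all \<open>k\<close>.\<close>

lemma codes_sample:
  assumes z: "(\<alpha>, y) \<in> codes"
  shows "\<exists>F. sample F = y \<and> (\<forall>n. F \<in> prefix_class \<alpha> n)"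
proof -
  have ex: "\<exists>F\<in>prefix_class \<alpha> k. sample F = y" for k
  proof -
    have "\<exists>g \<beta>. (\<forall>i<m + k. \<beta> i = \<alpha> i) \<and> g \<in> modulus_class \<beta> \<and>
              dist (sample g) y < inverse (real (Suc m))" for m
    proof -
      have "y \<in> closure (sample ` prefix_class \<alpha> (m + k))"
        using z by (simp add: codes_def)
      moreover have "0 < inverse (real (Suc m))"
        by simp
      ultimately have "\<exists>v\<in>sample ` prefix_class \<alpha> (m + k). dist v y < inverse (real (Suc m))"
        unfolding closure_approachable by blast
      then show ?thesis
        unfolding prefix_class_def by blast
    qed
    then obtain g \<beta> where agree: "\<And>m i. i < m + k \<Longrightarrow> \<beta> m i = \<alpha> i"
      and g: "\<And>m. g m \<in> modulus_class (\<beta> m)"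
      and close: "\<And>m. dist (sample (g m)) y < inverse (real (Suc m))"
      by metis
    obtain \<gamma> where \<gamma>: "\<forall>i<k. \<gamma> i = \<alpha> i" "\<And>m i. \<beta> m i \<le> \<gamma> i"
      using common_upper_bound_of_converging_sequences[of k \<beta> \<alpha>, OF agree] by blast
    have "g m \<in> modulus_class \<gamma>" for m
      using g modulus_class_mono[of "\<beta> m" \<gamma>] \<gamma>(2) by blast
    moreover have "(\<lambda>m. sample (g m)) \<longlonglongrightarrow> y"
      unfolding tendsto_dist_iff[of _ y]
    proof (rule Lim_null_comparison)
      show "(\<lambda>m. inverse (real (Suc m))) \<longlonglongrightarrow> 0"
        by (rule LIMSEQ_inverse_real_of_nat)
      show "\<forall>\<^sub>F m in sequentially. norm (dist (sample (g m)) y) \<le> inverse (real (Suc m))"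
        using close by (intro always_eventually) (simp add: less_imp_le)
    qed
    ultimately obtain F where "F \<in> modulus_class \<gamma>" "sample F = y"
      using modulus_class_limit[of g \<gamma> y] by blast
    then show ?thesis
      using \<gamma>(1) by (auto simp: prefix_class_def)
  qed
  obtain F where F: "F \<in> prefix_class \<alpha> 0" "sample F = y"
    using ex by blast
  have "F \<in> prefix_class \<alpha> n" for n
  proof -
    obtain G where G: "G \<in> prefix_class \<alpha> n" "sample G = y"
      using ex by blast
    then have "G = F"
      using F prefix_class_subset inj_on_sample by (metis inj_onD subsetD)
    then show ?thesis
      using G(1) by simp
  qed
  then show ?thesis
    using F(2) by blast
qed

lemma decode_codes:
  assumes "z \<in> codes"
  shows "sample (decode z) = snd z" "decode z \<in> prefix_class (fst z) n"
    "decode z \<in> real_cont_fun_set X"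
proof -
  obtain F where F: "sample F = snd z" "\<forall>n. F \<in> prefix_class (fst z) n"
    using codes_sample[of "fst z" "snd z"] assms by auto
  then have "F \<in> real_cont_fun_set X"
    using prefix_class_subset by blast
  moreover from this have "decode z = F"
    using F(1) by (intro decode_eq) simp_all
  ultimately show "sample (decode z) = snd z" "decode z \<in> prefix_class (fst z) n"
    "decode z \<in> real_cont_fun_set X"
    using F by simp_all
qed

lemma prefix_class_cong:
  assumes "\<forall>i<n. \<alpha> i = \<beta> i"
  shows "prefix_class \<alpha> n = prefix_class \<beta> n"
  using assms by (auto simp: prefix_class_def)

text \<open>The first component matters at level \<open>n\<close> only through its first \<open>n\<close> entries, which are
  eventually constant along a convergent sequence.\<close>

lemma closed_codes: "closed codes"
  unfolding closed_sequential_limits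
proof (intro allI impI, elim conjE)
  fix u :: "nat \<Rightarrow> (nat \<Rightarrow> nat) \<times> (nat \<Rightarrow> real)" and l
  assume u: "\<forall>m. u m \<in> codes" and lim: "u \<longlonglongrightarrow> l"
  have "snd l \<in> closure (sample ` prefix_class (fst l) n)" for n
  proof (rule Lim_in_closed_set)
    show "(\<lambda>m. snd (u m)) \<longlonglongrightarrow> snd l"
      using lim by (rule tendsto_snd)
    show "\<forall>\<^sub>F m in sequentially. snd (u m) \<in> closure (sample ` prefix_class (fst l) n)"
      using eventually_agree_below[OF tendsto_fst[OF lim], of n]
    proof eventually_elim
      case (elim m)
      have "snd (u m) \<in> closure (sample ` prefix_class (fst (u m)) n)"
        using u[rule_format, of m] by (auto simp: codes_def)
      then show ?case
        by (simp add: prefix_class_cong[OF elim])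
    qed
  qed simp_all
  then show "l \<in> codes"
    by (cases l) (simp add: codes_def)
qed

text \<open>Along a sequence of codes converging to \<open>l\<close>, pass to a subsequence whose \<open>m\<close>-th term agrees
  with \<open>l\<close> below \<open>m\<close>.  The decoded functions then lie in one modulus class, so convergence of
  their samples is uniform convergence on compact sets.\<close>

lemma closed_decode_preimage:
  assumes V: "V \<in> compact_open_subbase X"
  shows "closed {z \<in> codes. decode z \<notin> V}"
  unfolding closed_sequential_limits
proof (intro allI impI, elim conjE)
  fix u :: "nat \<Rightarrow> (nat \<Rightarrow> nat) \<times> (nat \<Rightarrow> real)" and l
  assume u: "\<forall>m. u m \<in> {z \<in> codes. decode z \<notin> V}" and lim: "u \<longlonglongrightarrow> l"
  have l: "l \<in> codes"
    using closed_codes u lim unfolding closed_sequential_limits by blast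
  have "decode l \<notin> V"
  proof
    assume lV: "decode l \<in> V"
    have "\<exists>j\<ge>m. \<forall>i<m. fst (u j) i = fst l i" for m
      using eventually_agree_below[OF tendsto_fst[OF lim], of m]
      unfolding eventually_sequentially by (meson linear order_refl)
    then obtain j where j: "\<And>m. j m \<ge> m" and agree: "\<And>m. \<forall>i<m. fst (u (j m)) i = fst l i"
      by metis
    define f where "f m = decode (u (j m))" for m
    have "\<exists>\<beta>. (\<forall>i<m. \<beta> i = fst l i) \<and> f m \<in> modulus_class \<beta>" for m
    proof -
      have "f m \<in> prefix_class (fst (u (j m))) m"
        unfolding f_def using u by (intro decode_codes(2)) blast
      then have "f m \<in> prefix_class (fst l) m"
        using prefix_class_cong[OF agree] by simp
      then show ?thesis
        by (auto simp: prefix_class_def)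
    qed
    then obtain \<beta> where \<beta>: "\<And>m i. i < m + 0 \<Longrightarrow> \<beta> m i = fst l i"
      and f\<beta>: "\<And>m. f m \<in> modulus_class (\<beta> m)"
      by (metis add.right_neutral)
    obtain \<gamma> where \<gamma>: "\<And>m i. \<beta> m i \<le> \<gamma> i"
      using common_upper_bound_of_converging_sequences[of 0 \<beta> "fst l", OF \<beta>] by blast
    have f\<gamma>: "f m \<in> modulus_class \<gamma>" for m
      using f\<beta> modulus_class_mono[of "\<beta> m" \<gamma>] \<gamma> by blast
    have "filterlim j at_top sequentially"
      by (rule filterlim_at_top_mono[OF filterlim_ident]) (use j in \<open>simp add: always_eventually\<close>)
    then have "(\<lambda>m. snd (u (j m))) \<longlonglongrightarrow> snd l"
      using tendsto_snd[OF lim] by (rule filterlim_compose[rotated])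
    moreover have "sample (f m) = snd (u (j m))" for m
      unfolding f_def using u by (intro decode_codes(1)) blast
    ultimately have "(\<lambda>m. sample (f m)) \<longlonglongrightarrow> snd l"
      by simp
    then obtain F where F: "F \<in> modulus_class \<gamma>" "sample F = snd l"
      and unif: "\<forall>K \<epsilon>. compactin X K \<longrightarrow> \<epsilon> > 0 \<longrightarrow>
              eventually (\<lambda>m. \<forall>x\<in>K. \<bar>f m x - F x\<bar> < \<epsilon>) sequentially"
      using modulus_class_limit[of f \<gamma>, OF f\<gamma>] by blast
    have "F \<in> V"
      using decode_eq[of F l] F modulus_class_subset lV by auto
    then have "eventually (\<lambda>m. f m \<in> V) sequentially"
      using unif f\<gamma> modulus_class_subset
      by (intro eventually_in_compact_open_subbase[OF V, of F]) blast+
    then show False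
      using u by (auto simp: f_def eventually_sequentially)
  qed
  then show "l \<in> {z \<in> codes. decode z \<notin> V}"
    using l by simp
qed

lemma continuous_decode: "continuous_map (top_of_set codes) (Ck X) decode"
  unfolding Ck_def continuous_on_generated_topo_iff
proof (intro conjI allI impI)
  fix V assume V: "V \<in> insert (real_cont_fun_set X) (compact_open_subbase X)"
  have "closed {z \<in> codes. decode z \<notin> V}"
  proof (cases "V \<in> compact_open_subbase X")
    case True
    then show ?thesis
      by (rule closed_decode_preimage)
  next
    case False
    then have "{z \<in> codes. decode z \<notin> V} = {}"
      using V decode_codes(3) by auto
    then show ?thesis
      by (simp only: closed_empty)
  qed
  then have "openin (top_of_set codes) (codes - {z \<in> codes. decode z \<notin> V})"
    by (intro openin_diff closed_subset) auto
  moreover have "decode -` V \<inter> topspace (top_of_set codes) = codes - {z \<in> codes. decode z \<notin> V}"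
    by auto
  ultimately show "openin (top_of_set codes) (decode -` V \<inter> topspace (top_of_set codes))"
    by simp
next
  show "decode ` topspace (top_of_set codes) \<subseteq> \<Union>(insert (real_cont_fun_set X) (compact_open_subbase X))"
    using decode_codes(3) by auto
qed

lemma decode_surj: "decode ` codes = real_cont_fun_set X"
proof
  show "real_cont_fun_set X \<subseteq> decode ` codes"
  proof
    fix f assume f: "f \<in> real_cont_fun_set X"
    obtain \<beta> where "f \<in> modulus_class \<beta>"
      using modulus_class_cover[OF f] by blast
    then have "f \<in> prefix_class \<beta> n" for n
      by (auto simp: prefix_class_def)
    then have "(\<beta>, sample f) \<in> codes"
      using closure_subset by (fastforce simp: codes_def)
    moreover have "decode (\<beta>, sample f) = f"
      using f by (intro decode_eq) simp_all
    ultimately show "f \<in> decode ` codes"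
      by (metis imageI)
  qed
qed (use decode_codes(3) in auto)

lemma Polish_codes: "Polish_space (top_of_set codes)"
  using closed_codes by (rule Polish_space_closed_subset)

lemma Suslin_Ck: "Suslin_space (Ck X)"
  using Polish_codes continuous_decode
  by (rule Suslin_spaceI) (simp add: decode_surj topspace_Ck)

end

text \<open>The dense sequence of the general case does not exist when \<open>X\<close> is empty; then \<open>C\<^sub>k(X)\<close> is a
  single point.\<close>

lemma Suslin_Ck_empty:
  assumes "topspace X = {}"
  shows "Suslin_space (Ck X)"
proof -
  have eq: "topspace (Ck X) = {\<lambda>_. undefined}"
    using assms unfolding topspace_Ck real_cont_fun_set_def
    by (auto simp: extensional_def continuous_map_def)
  show ?thesis
  proof (rule Suslin_spaceI)
    show "Polish_space (discrete_topology (topspace (Ck X)))"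
      by (simp add: Polish_space_def eq completely_metrizable_space_discrete_topology
          separable_space_discrete_topology)
    show "continuous_map (discrete_topology (topspace (Ck X))) (Ck X) id"
      by simp
  qed simp
qed

lemma separable_uniformity_imp_Suslin_Ck:
  assumes sep: "separable_space X" and "has_R_universal_omega_omega_based_uniformity X"
  shows "Suslin_space (Ck X)"
proof (cases "topspace X = {}")
  case True
  then show ?thesis
    by (rule Suslin_Ck_empty)
next
  case False
  obtain \<U> where unif: "uniformity_on_set (topspace X) \<U>" and univ: "R_universal X \<U>"
    and "omega_omega_based \<U>"
    using assms(2) unfolding has_R_universal_omega_omega_based_uniformity_def by blast
  then obtain B :: "(nat \<Rightarrow> nat) \<Rightarrow> _" where B: "\<forall>\<alpha>. B \<alpha> \<in> \<U>" "\<forall>U\<in>\<U>. \<exists>\<alpha>. B \<alpha> \<subseteq> U"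
      "\<forall>\<alpha> \<beta>. (\<forall>n. \<alpha> n \<le> \<beta> n) \<longrightarrow> B \<beta> \<subseteq> B \<alpha>"
    unfolding omega_omega_based_def by blast
  obtain D where D: "countable D" "D \<subseteq> topspace X" "X closure_of D = topspace X"
    using sep unfolding separable_space_def by blast
  have "D \<noteq> {}"
    using D(3) False closure_of_empty by metis
  then have range: "range (from_nat_into D) = D"
    using D(1) by (simp add: range_from_nat_into)
  interpret separable_omega_omega_based_uniformity X \<U> B "from_nat_into D"
    using unif univ B D range
    by unfold_locales (auto simp: R_universal_def)
  show ?thesis
    by (rule Suslin_Ck)
qed

theorem theorem1p5:
  fixes X :: "'a topology"
  assumes "Tychonoff_space X"
  shows
    "(separable_space X \<and> has_R_universal_omega_omega_based_uniformity X
        \<longrightarrow> Suslin_space (Ck X)) \<and>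
     (Ascoli_space X \<and> Suslin_space (Ck X)
        \<longrightarrow> separable_space X \<and> has_R_universal_omega_omega_based_uniformity X) \<and>
     (Ascoli_space X
        \<longrightarrow> (Suslin_space (Ck X) \<longleftrightarrow>
             separable_space X \<and> has_R_universal_omega_omega_based_uniformity X))"
  using separable_uniformity_imp_Suslin_Ck[of X] Suslin_Ck_imp_separable[of X]
    Ascoli_Suslin_Ck_imp_uniformity[of X] assms
  unfolding Tychonoff_space_def by blast

end
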